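(* Let $R$ be an excellent domain of equal characteristic zero with a dualizing complex, let $\mathfrak a,J=(x_1,\dots,x_n)\subseteq R$ be nonzero ideals with $\mathfrak a\subseteq\sqrt J$, and let $Z\to\operatorname{Spec}R$ be a log resolution of $(R,\mathfrak a)$ with $\mathfrak a\mathcal O_Z=\mathcal O_Z(-D)$. Assume that $c_{\mathrm{Hir}}^J(\mathfrak a)$ and $c_{\mathrm{KH}}^J(\mathfrak a)$ are finite. Then the infima defining them are minima, that is, $$c_{\mathrm{Hir}}^J(\mathfrak a)=\min\{t\ge 0 : R\to R/J\otimes_R^{\mathbf L}\mathbf R\Gamma(Z,\mathcal O_Z(\lfloor tD\rfloor))\text{ is zero in }D(R)\},$$ $$c_{\mathrm{KH}}^J(\mathfrak a)=\min\{t\ge 0 : R\to \mathrm{Kos}_\bullet(\underline x)\otimes_R^{\mathbf L}\mathbf R\Gamma(Z,\mathcal O_Z(\lfloor tD\rfloor))\text{ is zero in }D(R)\}.$$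
   Context: Equal characteristic zero means $\mathbb Q\subseteq R$. A log resolution of $(R,\mathfrak a)$ is a proper birational morphism $\pi:Z\to\operatorname{Spec}R$ with $Z$ nonsingular integral, $\mathfrak a\mathcal O_Z=\mathcal O_Z(-D)$ for a divisor $D$ with simple normal crossing support, and exceptional set a divisor having simple normal crossing support together with $D$. Derived Hironaka threshold $c_{\mathrm{Hir}}^J(\mathfrak a)$ and derived Koszul-Hironaka threshold $c_{\mathrm{KH}}^J(\mathfrak a)$: by definition these are the infima of the two sets displayed in the claim. Here $\mathrm{Kos}_\bullet(\underline x)$ is the Koszul complex, and the maps are the canonical ones induced by $R\to R/J$ (resp. $R\to\mathrm{Kos}_\bullet(\underline x)$) and $R\to\mathbf R\Gamma(Z,\mathcal O_Z)\to\mathbf R\Gamma(Z,\mathcal O_Z(\lfloor tD\rfloor))$. *)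

theory Defs
  imports
    "HOL-Algebra.Ideal_Product"
    "HOL-Algebra.Generated_Rings"
    "HOL-Algebra.Ring_Divisibility"
    "HOL-Algebra.QuotRing"
    "HOL-Library.Extended_Nat"
    "HOL-Library.Extended_Real"
    "HOL-Library.Multiset"
    "HOL-Analysis.Abstract_Topology"
begin

section \<open>Commutative algebra\<close>

definition prime_ideals :: "('a, 'x) ring_scheme \<Rightarrow> 'a set set" where
  "prime_ideals A = {p. primeideal p A}"

definition krull_dim :: "('a, 'x) ring_scheme \<Rightarrow> enat" where
  "krull_dim A = Sup {enat n | n. \<exists>c :: nat \<Rightarrow> 'a set.
     (\<forall>i\<le>n. c i \<in> prime_ideals A) \<and> (\<forall>i<n. c i \<subset> c (Suc i))}"

definition local_ring :: "('a, 'x) ring_scheme \<Rightarrow> bool" where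
  "local_ring A \<longleftrightarrow> cring A \<and> (\<exists>!m. maximalideal m A)"

definition max_ideal :: "('a, 'x) ring_scheme \<Rightarrow> 'a set" where
  "max_ideal A = (THE m. maximalideal m A)"

definition regular_parameters :: "('a, 'x) ring_scheme \<Rightarrow> 'a list \<Rightarrow> bool" where
  "regular_parameters A xs \<longleftrightarrow> set xs \<subseteq> carrier A \<and> enat (length xs) = krull_dim A
     \<and> genideal A (set xs) = max_ideal A"

definition regular_local_ring :: "('a, 'x) ring_scheme \<Rightarrow> bool" where
  "regular_local_ring A \<longleftrightarrow> noetherian_ring A \<and> local_ring A \<and> (\<exists>xs. regular_parameters A xs)"

definition radical :: "('a, 'x) ring_scheme \<Rightarrow> 'a set \<Rightarrow> 'a set" where
  "radical A I = {x \<in> carrier A. \<exists>n::nat. x [^]\<^bsub>A\<^esub> n \<in> I}"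

definition rat_ring :: "rat ring" where
  "rat_ring = \<lparr>carrier = UNIV, monoid.mult = (*), one = 1, zero = 0, add = (+)\<rparr>"

definition contains_rationals :: "('a, 'x) ring_scheme \<Rightarrow> bool" where
  "contains_rationals A \<longleftrightarrow> (\<exists>h \<in> ring_hom rat_ring A. inj h)"

text \<open>The fraction \<open>a/s\<close> in \<open>S\<^sup>-\<^sup>1A\<close>, as an equivalence class of pairs.\<close>

definition frac :: "('a, 'x) ring_scheme \<Rightarrow> 'a set \<Rightarrow> 'a \<Rightarrow> 'a \<Rightarrow> ('a \<times> 'a) set" where
  "frac A S a s = {(b, t). b \<in> carrier A \<and> t \<in> S
     \<and> (\<exists>u\<in>S. u \<otimes>\<^bsub>A\<^esub> (a \<otimes>\<^bsub>A\<^esub> t) = u \<otimes>\<^bsub>A\<^esub> (b \<otimes>\<^bsub>A\<^esub> s))}"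

definition localization :: "('a, 'x) ring_scheme \<Rightarrow> 'a set \<Rightarrow> ('a \<times> 'a) set ring" where
  "localization A S =
    \<lparr>carrier = {frac A S a s | a s. a \<in> carrier A \<and> s \<in> S},
     monoid.mult = (\<lambda>X Y. THE Z. \<exists>a\<in>carrier A. \<exists>b\<in>carrier A. \<exists>s\<in>S. \<exists>t\<in>S.
        X = frac A S a s \<and> Y = frac A S b t \<and> Z = frac A S (a \<otimes>\<^bsub>A\<^esub> b) (s \<otimes>\<^bsub>A\<^esub> t)),
     one = frac A S \<one>\<^bsub>A\<^esub> \<one>\<^bsub>A\<^esub>,
     zero = frac A S \<zero>\<^bsub>A\<^esub> \<one>\<^bsub>A\<^esub>,
     add = (\<lambda>X Y. THE Z. \<exists>a\<in>carrier A. \<exists>b\<in>carrier A. \<exists>s\<in>S. \<exists>t\<in>S.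
        X = frac A S a s \<and> Y = frac A S b t
        \<and> Z = frac A S ((a \<otimes>\<^bsub>A\<^esub> t) \<oplus>\<^bsub>A\<^esub> (b \<otimes>\<^bsub>A\<^esub> s)) (s \<otimes>\<^bsub>A\<^esub> t))\<rparr>"

abbreviation localization_at :: "('a, 'x) ring_scheme \<Rightarrow> 'a set \<Rightarrow> ('a \<times> 'a) set ring" where
  "localization_at A p \<equiv> localization A (carrier A - p)"

definition regular_ring :: "('a, 'x) ring_scheme \<Rightarrow> bool" where
  "regular_ring A \<longleftrightarrow> cring A \<and> noetherian_ring A
     \<and> (\<forall>p\<in>prime_ideals A. regular_local_ring (localization_at A p))"

subsection \<open>Modules and tensor products\<close>

definition alg_module :: "('r \<Rightarrow> 'a) \<Rightarrow> ('a, 'x) ring_scheme \<Rightarrow> ('r, 'a) module" where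
  "alg_module \<phi> A = \<lparr>carrier = carrier A, monoid.mult = monoid.mult A, one = one A, zero = zero A, add = add A,
     smult = (\<lambda>r a. \<phi> r \<otimes>\<^bsub>A\<^esub> a)\<rparr>"

definition restrict_scalars :: "('r \<Rightarrow> 's) \<Rightarrow> ('s, 'm) module \<Rightarrow> ('r, 'm) module" where
  "restrict_scalars \<phi> M = \<lparr>carrier = carrier M, monoid.mult = monoid.mult M, one = one M, zero = zero M,
     add = add M, smult = (\<lambda>r m. \<phi> r \<odot>\<^bsub>M\<^esub> m)\<rparr>"

definition zero_submodule :: "('r, 'm) module \<Rightarrow> ('r, 'm) module" where
  "zero_submodule M = M\<lparr>carrier := {\<zero>\<^bsub>M\<^esub>}\<rparr>"

definition mod_hom ::
  "('r, 'x) ring_scheme \<Rightarrow> ('r, 'm) module \<Rightarrow> ('r, 'n) module \<Rightarrow> ('m \<Rightarrow> 'n) set" where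
  "mod_hom A M N = {f \<in> carrier M \<rightarrow> carrier N.
     (\<forall>x\<in>carrier M. \<forall>y\<in>carrier M. f (x \<oplus>\<^bsub>M\<^esub> y) = f x \<oplus>\<^bsub>N\<^esub> f y)
     \<and> (\<forall>r\<in>carrier A. \<forall>x\<in>carrier M. f (r \<odot>\<^bsub>M\<^esub> x) = r \<odot>\<^bsub>N\<^esub> f x)}"

definition mod_span :: "('r, 'x) ring_scheme \<Rightarrow> ('r, 'm) module \<Rightarrow> 'm set \<Rightarrow> 'm set" where
  "mod_span A M G = \<Inter>{H. submodule H A M \<and> G \<subseteq> H}"

definition indicator_elt :: "('r, 'x) ring_scheme \<Rightarrow> 's \<Rightarrow> 's \<Rightarrow> 'r" where
  "indicator_elt A x = (\<lambda>y. if y = x then \<one>\<^bsub>A\<^esub> else \<zero>\<^bsub>A\<^esub>)"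

text \<open>Only the module structure of the free module is meaningful; likewise, the multiplicative
  fields of a \<open>module\<close> record are used only for algebras.\<close>

definition free_module :: "('r, 'x) ring_scheme \<Rightarrow> 's set \<Rightarrow> ('r, 's \<Rightarrow> 'r) module" where
  "free_module A S =
    \<lparr>carrier = {\<phi>. range \<phi> \<subseteq> carrier A \<and> finite {x. \<phi> x \<noteq> \<zero>\<^bsub>A\<^esub>} \<and> {x. \<phi> x \<noteq> \<zero>\<^bsub>A\<^esub>} \<subseteq> S},
     monoid.mult = undefined, one = undefined,
     zero = (\<lambda>x. \<zero>\<^bsub>A\<^esub>),
     add = (\<lambda>\<phi> \<psi> x. \<phi> x \<oplus>\<^bsub>A\<^esub> \<psi> x),
     smult = (\<lambda>r \<phi> x. r \<otimes>\<^bsub>A\<^esub> \<phi> x)\<rparr>"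

text \<open>\<open>M \<otimes>\<^sub>A N\<close> is the free module on \<open>M \<times> N\<close> modulo the bilinearity relations.  If \<open>M\<close> and \<open>N\<close>
  are \<open>A\<close>-algebras, the record also carries the ring structure of \<open>M \<otimes>\<^sub>A N\<close>.\<close>

definition tensor_relations ::
  "('r, 'x) ring_scheme \<Rightarrow> ('r, 'm) module \<Rightarrow> ('r, 'n) module \<Rightarrow> ('m \<times> 'n \<Rightarrow> 'r) set" where
  "tensor_relations A M N =
    (let F = free_module A (carrier M \<times> carrier N); d = (\<lambda>m n. indicator_elt A (m, n)) in
     mod_span A F
      ({d (m \<oplus>\<^bsub>M\<^esub> m') n \<ominus>\<^bsub>F\<^esub> (d m n \<oplus>\<^bsub>F\<^esub> d m' n) | m m' n.
          m \<in> carrier M \<and> m' \<in> carrier M \<and> n \<in> carrier N}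
       \<union> {d m (n \<oplus>\<^bsub>N\<^esub> n') \<ominus>\<^bsub>F\<^esub> (d m n \<oplus>\<^bsub>F\<^esub> d m n') | m n n'.
          m \<in> carrier M \<and> n \<in> carrier N \<and> n' \<in> carrier N}
       \<union> {d (r \<odot>\<^bsub>M\<^esub> m) n \<ominus>\<^bsub>F\<^esub> (r \<odot>\<^bsub>F\<^esub> d m n) | r m n.
          r \<in> carrier A \<and> m \<in> carrier M \<and> n \<in> carrier N}
       \<union> {d m (r \<odot>\<^bsub>N\<^esub> n) \<ominus>\<^bsub>F\<^esub> (r \<odot>\<^bsub>F\<^esub> d m n) | r m n.
          r \<in> carrier A \<and> m \<in> carrier M \<and> n \<in> carrier N}))"

definition tensor_class :: "('r, 'x) ring_scheme \<Rightarrow> ('r, 'm) module \<Rightarrow> ('r, 'n) module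
    \<Rightarrow> ('m \<times> 'n \<Rightarrow> 'r) \<Rightarrow> ('m \<times> 'n \<Rightarrow> 'r) set" where
  "tensor_class A M N \<phi> =
     tensor_relations A M N +>\<^bsub>free_module A (carrier M \<times> carrier N)\<^esub> \<phi>"

definition convolution :: "('r, 'x) ring_scheme \<Rightarrow> ('r, 'm) module \<Rightarrow> ('r, 'n) module
    \<Rightarrow> ('m \<times> 'n \<Rightarrow> 'r) \<Rightarrow> ('m \<times> 'n \<Rightarrow> 'r) \<Rightarrow> ('m \<times> 'n \<Rightarrow> 'r)" where
  "convolution A M N \<phi> \<psi> = (\<lambda>z. finsum A (\<lambda>(x, y). \<phi> x \<otimes>\<^bsub>A\<^esub> \<psi> y)
     {(x, y). \<phi> x \<noteq> \<zero>\<^bsub>A\<^esub> \<and> \<psi> y \<noteq> \<zero>\<^bsub>A\<^esub> \<and> (fst x \<otimes>\<^bsub>M\<^esub> fst y, snd x \<otimes>\<^bsub>N\<^esub> snd y) = z})"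

definition tensor :: "('r, 'x) ring_scheme \<Rightarrow> ('r, 'm) module \<Rightarrow> ('r, 'n) module
    \<Rightarrow> ('r, ('m \<times> 'n \<Rightarrow> 'r) set) module" where
  "tensor A M N = (let F = free_module A (carrier M \<times> carrier N); cl = tensor_class A M N in
    \<lparr>carrier = cl ` carrier F,
     monoid.mult = (\<lambda>X Y. THE Z. \<exists>\<phi>\<in>X. \<exists>\<psi>\<in>Y. Z = cl (convolution A M N \<phi> \<psi>)),
     one = cl (indicator_elt A (\<one>\<^bsub>M\<^esub>, \<one>\<^bsub>N\<^esub>)),
     zero = cl \<zero>\<^bsub>F\<^esub>,
     add = (\<lambda>X Y. THE Z. \<exists>\<phi>\<in>X. \<exists>\<psi>\<in>Y. Z = cl (\<phi> \<oplus>\<^bsub>F\<^esub> \<psi>)),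
     smult = (\<lambda>r X. THE Z. \<exists>\<phi>\<in>X. Z = cl (r \<odot>\<^bsub>F\<^esub> \<phi>))\<rparr>)"

definition pure_tensor ::
  "('r, 'x) ring_scheme \<Rightarrow> ('r, 'm) module \<Rightarrow> ('r, 'n) module \<Rightarrow> 'm \<Rightarrow> 'n \<Rightarrow> ('m \<times> 'n \<Rightarrow> 'r) set" where
  "pure_tensor A M N m n = tensor_class A M N (indicator_elt A (m, n))"

text \<open>\<open>f \<otimes> g : M \<otimes> N \<rightarrow> M' \<otimes> N'\<close>.\<close>

definition tensor_map :: "('r, 'x) ring_scheme \<Rightarrow> ('r, 'm) module \<Rightarrow> ('r, 'n) module
    \<Rightarrow> ('m \<Rightarrow> 'm) \<Rightarrow> ('n \<Rightarrow> 'n) \<Rightarrow> ('m \<times> 'n \<Rightarrow> 'r) set \<Rightarrow> ('m \<times> 'n \<Rightarrow> 'r) set" where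
  "tensor_map A M' N' f g = (\<lambda>X. THE Z. \<exists>\<phi>\<in>X. Z = finsum (tensor A M' N')
     (\<lambda>(m, n). \<phi> (m, n) \<odot>\<^bsub>tensor A M' N'\<^esub> pure_tensor A M' N' (f m) (g n))
     {(m, n). \<phi> (m, n) \<noteq> \<zero>\<^bsub>A\<^esub>})"

subsection \<open>Excellent rings\<close>

definition mpoly :: "('a, 'x) ring_scheme \<Rightarrow> nat \<Rightarrow> (nat multiset \<Rightarrow> 'a) ring" where
  "mpoly A n =
    \<lparr>carrier = {f. range f \<subseteq> carrier A \<and> finite {m. f m \<noteq> \<zero>\<^bsub>A\<^esub>}
        \<and> (\<forall>m. f m \<noteq> \<zero>\<^bsub>A\<^esub> \<longrightarrow> set_mset m \<subseteq> {..<n})},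
     monoid.mult = (\<lambda>f g m. finsum A (\<lambda>k. f k \<otimes>\<^bsub>A\<^esub> g (m - k)) {k. k \<subseteq># m}),
     one = (\<lambda>m. if m = {#} then \<one>\<^bsub>A\<^esub> else \<zero>\<^bsub>A\<^esub>),
     zero = (\<lambda>m. \<zero>\<^bsub>A\<^esub>),
     add = (\<lambda>f g m. f m \<oplus>\<^bsub>A\<^esub> g m)\<rparr>"

definition mpoly_const :: "('a, 'x) ring_scheme \<Rightarrow> 'a \<Rightarrow> nat multiset \<Rightarrow> 'a" where
  "mpoly_const A a = (\<lambda>m. if m = {#} then a else \<zero>\<^bsub>A\<^esub>)"

text \<open>Up to isomorphism, these are all finitely generated \<open>A\<close>-algebras, given with their
  structure homomorphism.\<close>

definition fg_algebras ::
  "('a, 'x) ring_scheme \<Rightarrow> ((nat multiset \<Rightarrow> 'a) set ring \<times> ('a \<Rightarrow> (nat multiset \<Rightarrow> 'a) set)) set" where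
  "fg_algebras A = {(mpoly A n Quot I, \<lambda>a. I +>\<^bsub>mpoly A n\<^esub> mpoly_const A a) | n I.
     ideal I (mpoly A n)}"

definition prime_chain :: "('a, 'x) ring_scheme \<Rightarrow> 'a set \<Rightarrow> 'a set \<Rightarrow> 'a set list \<Rightarrow> bool" where
  "prime_chain A p q c \<longleftrightarrow> c \<noteq> [] \<and> hd c = p \<and> last c = q \<and> set c \<subseteq> prime_ideals A
     \<and> (\<forall>i. Suc i < length c \<longrightarrow> c ! i \<subset> c ! Suc i)"

definition saturated_prime_chain :: "('a, 'x) ring_scheme \<Rightarrow> 'a set \<Rightarrow> 'a set \<Rightarrow> 'a set list \<Rightarrow> bool" where
  "saturated_prime_chain A p q c \<longleftrightarrow> prime_chain A p q c
     \<and> (\<forall>i. Suc i < length c \<longrightarrow> \<not> (\<exists>r\<in>prime_ideals A. c ! i \<subset> r \<and> r \<subset> c ! Suc i))"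

definition catenary :: "('a, 'x) ring_scheme \<Rightarrow> bool" where
  "catenary A \<longleftrightarrow> (\<forall>p\<in>prime_ideals A. \<forall>q\<in>prime_ideals A. p \<subseteq> q \<longrightarrow>
     (\<exists>N. \<forall>c. prime_chain A p q c \<longrightarrow> length c \<le> N)
     \<and> (\<forall>c c'. saturated_prime_chain A p q c \<and> saturated_prime_chain A p q c'
           \<longrightarrow> length c = length c'))"

definition universally_catenary :: "('a, 'x) ring_scheme \<Rightarrow> bool" where
  "universally_catenary A \<longleftrightarrow> (\<forall>(B, \<phi>)\<in>fg_algebras A. catenary B)"

fun ideal_power :: "('a, 'x) ring_scheme \<Rightarrow> 'a set \<Rightarrow> nat \<Rightarrow> 'a set" where
  "ideal_power A I 0 = carrier A"
| "ideal_power A I (Suc n) = ideal_prod A I (ideal_power A I n)"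

text \<open>The \<open>I\<close>-adic completion, the inverse limit of the rings \<open>A/I\<^sup>n\<close>.\<close>

definition completion :: "('a, 'x) ring_scheme \<Rightarrow> 'a set \<Rightarrow> (nat \<Rightarrow> 'a set) ring" where
  "completion A I = (let Q = (\<lambda>n. A Quot ideal_power A I n) in
    \<lparr>carrier = {x. (\<forall>n. x n \<in> carrier (Q n)) \<and> (\<forall>n. x (Suc n) \<subseteq> x n)},
     monoid.mult = (\<lambda>x y n. x n \<otimes>\<^bsub>Q n\<^esub> y n),
     one = (\<lambda>n. \<one>\<^bsub>Q n\<^esub>),
     zero = (\<lambda>n. \<zero>\<^bsub>Q n\<^esub>),
     add = (\<lambda>x y n. x n \<oplus>\<^bsub>Q n\<^esub> y n)\<rparr>)"

definition completion_map :: "('a, 'x) ring_scheme \<Rightarrow> 'a set \<Rightarrow> 'a \<Rightarrow> nat \<Rightarrow> 'a set" where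
  "completion_map A I a = (\<lambda>n. ideal_power A I n +>\<^bsub>A\<^esub> a)"

definition residue_field :: "('a, 'x) ring_scheme \<Rightarrow> 'a set \<Rightarrow> ('a \<times> 'a) set set ring" where
  "residue_field A p = localization_at A p Quot max_ideal (localization_at A p)"

definition residue_map :: "('a, 'x) ring_scheme \<Rightarrow> 'a set \<Rightarrow> 'a \<Rightarrow> ('a \<times> 'a) set set" where
  "residue_map A p a =
     max_ideal (localization_at A p) +>\<^bsub>localization_at A p\<^esub> frac A (carrier A - p) a \<one>\<^bsub>A\<^esub>"

text \<open>By Zariski's lemma, the finitely generated \<open>k\<close>-algebras that are fields are exactly the finite
  field extensions of \<open>k\<close>.\<close>

definition geometrically_regular ::
  "('k, 'x) ring_scheme \<Rightarrow> ('k \<Rightarrow> 'b) \<Rightarrow> ('b, 'y) ring_scheme \<Rightarrow> bool" where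
  "geometrically_regular k \<phi> B \<longleftrightarrow>
     (\<forall>(L, \<iota>)\<in>fg_algebras k. field L \<longrightarrow>
        regular_ring (tensor k (alg_module \<iota> L) (alg_module \<phi> B)))"

text \<open>For every prime \<open>p\<close>, the fibres of \<open>A\<^sub>p\<close> into its completion are geometrically regular.\<close>

definition G_ring :: "('a, 'x) ring_scheme \<Rightarrow> bool" where
  "G_ring A \<longleftrightarrow> (\<forall>p\<in>prime_ideals A. let B = localization_at A p; m = max_ideal B in
     \<forall>q\<in>prime_ideals B.
       let k = residue_field B q;
           K = alg_module (residue_map B q) k;
           C = alg_module (completion_map B m) (completion B m)
       in geometrically_regular k (\<lambda>x. pure_tensor B K C x \<one>\<^bsub>C\<^esub>) (tensor B K C))"

definition spec_topology :: "('a, 'x) ring_scheme \<Rightarrow> 'a set topology" where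
  "spec_topology A =
     topology (\<lambda>U. \<exists>I\<subseteq>carrier A. U = {p \<in> prime_ideals A. \<not> I \<subseteq> p})"

definition J2_ring :: "('a, 'x) ring_scheme \<Rightarrow> bool" where
  "J2_ring A \<longleftrightarrow> (\<forall>(B, \<phi>)\<in>fg_algebras A.
     openin (spec_topology B) {p \<in> prime_ideals B. regular_local_ring (localization_at B p)})"

definition excellent_ring :: "('a, 'x) ring_scheme \<Rightarrow> bool" where
  "excellent_ring A \<longleftrightarrow> cring A \<and> noetherian_ring A \<and> universally_catenary A \<and> G_ring A \<and> J2_ring A"

section \<open>Complexes of modules and the derived category\<close>

text \<open>Cohomological indexing.\<close>

record ('r, 'm) mod_complex =
  cobj :: "int \<Rightarrow> ('r, 'm) module"
  cdiff :: "int \<Rightarrow> 'm \<Rightarrow> 'm"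

definition is_complex :: "('r, 'x) ring_scheme \<Rightarrow> ('r, 'm) mod_complex \<Rightarrow> bool" where
  "is_complex A C \<longleftrightarrow> (\<forall>n. module A (cobj C n) \<and> cdiff C n \<in> mod_hom A (cobj C n) (cobj C (n + 1))
     \<and> (\<forall>x\<in>carrier (cobj C n). cdiff C (n + 1) (cdiff C n x) = \<zero>\<^bsub>cobj C (n + 2)\<^esub>))"

definition cycles :: "('r, 'm) mod_complex \<Rightarrow> int \<Rightarrow> 'm set" where
  "cycles C n = {x \<in> carrier (cobj C n). cdiff C n x = \<zero>\<^bsub>cobj C (n + 1)\<^esub>}"

definition boundaries :: "('r, 'm) mod_complex \<Rightarrow> int \<Rightarrow> 'm set" where
  "boundaries C n = cdiff C (n - 1) ` carrier (cobj C (n - 1))"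

definition chain_map ::
  "('r, 'x) ring_scheme \<Rightarrow> ('r, 'm) mod_complex \<Rightarrow> ('r, 'n) mod_complex \<Rightarrow> (int \<Rightarrow> 'm \<Rightarrow> 'n) \<Rightarrow> bool" where
  "chain_map A C D f \<longleftrightarrow> (\<forall>n. f n \<in> mod_hom A (cobj C n) (cobj D n)
     \<and> (\<forall>x\<in>carrier (cobj C n). f (n + 1) (cdiff C n x) = cdiff D n (f n x)))"

text \<open>The two clauses are injectivity and surjectivity of \<open>H\<^sup>n(f)\<close>.\<close>

definition quasi_iso ::
  "('r, 'x) ring_scheme \<Rightarrow> ('r, 'm) mod_complex \<Rightarrow> ('r, 'n) mod_complex \<Rightarrow> (int \<Rightarrow> 'm \<Rightarrow> 'n) \<Rightarrow> bool" where
  "quasi_iso A C D f \<longleftrightarrow> chain_map A C D f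
     \<and> (\<forall>n. (\<forall>x\<in>cycles C n. f n x \<in> boundaries D n \<longrightarrow> x \<in> boundaries C n)
          \<and> (\<forall>y\<in>cycles D n. \<exists>x\<in>cycles C n. y \<ominus>\<^bsub>cobj D n\<^esub> f n x \<in> boundaries D n))"

definition null_homotopic ::
  "('r, 'x) ring_scheme \<Rightarrow> ('r, 'm) mod_complex \<Rightarrow> ('r, 'n) mod_complex \<Rightarrow> (int \<Rightarrow> 'm \<Rightarrow> 'n) \<Rightarrow> bool" where
  "null_homotopic A C D f \<longleftrightarrow> (\<exists>h. \<forall>n. h n \<in> mod_hom A (cobj C n) (cobj D (n - 1))
     \<and> (\<forall>x\<in>carrier (cobj C n).
          f n x = cdiff D (n - 1) (h n x) \<oplus>\<^bsub>cobj D n\<^esub> h (n + 1) (cdiff C n x)))"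

text \<open>\<open>D(A)\<close> is the localization of the homotopy category at the quasi-isomorphisms; by the calculus
  of fractions, a chain map \<open>f\<close> becomes zero in \<open>D(A)\<close> iff \<open>f \<circ> q\<close> is null-homotopic for some
  quasi-isomorphism \<open>q\<close> into its source.  Below, the source of \<open>f\<close> is always the free module \<open>A\<close>
  itself, so there is no loss in letting the source of \<open>q\<close> range over complexes on the same type.\<close>

definition zero_in_derived_category ::
  "('r, 'x) ring_scheme \<Rightarrow> ('r, 'm) mod_complex \<Rightarrow> ('r, 'n) mod_complex \<Rightarrow> (int \<Rightarrow> 'm \<Rightarrow> 'n) \<Rightarrow> bool" where
  "zero_in_derived_category A C D f \<longleftrightarrow> chain_map A C D f
     \<and> (\<exists>(C' :: ('r, 'm) mod_complex) q. is_complex A C' \<and> quasi_iso A C' C q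
          \<and> null_homotopic A C' D (\<lambda>n. f n \<circ> q n))"

definition in_degree_zero :: "('r, 'm) module \<Rightarrow> ('r, 'm) mod_complex" where
  "in_degree_zero M = \<lparr>cobj = (\<lambda>n. if n = 0 then M else zero_submodule M), cdiff = (\<lambda>n x. \<zero>\<^bsub>M\<^esub>)\<rparr>"

definition ring_complex :: "('r, 'x) ring_scheme \<Rightarrow> ('r, 'r) mod_complex" where
  "ring_complex A = in_degree_zero (alg_module (\<lambda>r. r) A)"

text \<open>Term of degree \<open>n\<close>: \<open>\<Oplus>\<^sub>i C\<^sup>i \<otimes> D\<^sup>n\<^sup>-\<^sup>i\<close>; differential \<open>d \<otimes> 1 + (-1)\<^sup>i 1 \<otimes> d\<close>.\<close>

definition tensor_complex :: "('r, 'x) ring_scheme \<Rightarrow> ('r, 'm) mod_complex \<Rightarrow> ('r, 'n) mod_complex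
    \<Rightarrow> ('r, int \<Rightarrow> ('m \<times> 'n \<Rightarrow> 'r) set) mod_complex" where
  "tensor_complex A C D = (let T = (\<lambda>i j. tensor A (cobj C i) (cobj D j)) in
    \<lparr>cobj = (\<lambda>n.
      \<lparr>carrier = {x. (\<forall>i. x i \<in> carrier (T i (n - i))) \<and> finite {i. x i \<noteq> \<zero>\<^bsub>T i (n - i)\<^esub>}},
       monoid.mult = undefined, one = undefined,
       zero = (\<lambda>i. \<zero>\<^bsub>T i (n - i)\<^esub>),
       add = (\<lambda>x y i. x i \<oplus>\<^bsub>T i (n - i)\<^esub> y i),
       smult = (\<lambda>r x i. r \<odot>\<^bsub>T i (n - i)\<^esub> x i)\<rparr>),
     cdiff = (\<lambda>n x i.
       let u = tensor_map A (cobj C i) (cobj D (n + 1 - i)) (cdiff C (i - 1)) (\<lambda>y. y) (x (i - 1));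
           v = tensor_map A (cobj C i) (cobj D (n + 1 - i)) (\<lambda>y. y) (cdiff D (n - i)) (x i)
       in u \<oplus>\<^bsub>T i (n + 1 - i)\<^esub> (if even i then v else \<ominus>\<^bsub>T i (n + 1 - i)\<^esub> v))\<rparr>)"

text \<open>The map \<open>A \<rightarrow> C \<otimes> D\<close>, \<open>r \<mapsto> e \<otimes> \<kappa>(r)\<close>, for \<open>e \<in> C\<^sup>0\<close> and \<open>\<kappa> : A \<rightarrow> D\<^sup>0\<close>.\<close>

definition map_to_tensor :: "('r, 'x) ring_scheme \<Rightarrow> ('r, 'm) mod_complex \<Rightarrow> ('r, 'n) mod_complex
    \<Rightarrow> 'm \<Rightarrow> ('r \<Rightarrow> 'n) \<Rightarrow> int \<Rightarrow> 'r \<Rightarrow> int \<Rightarrow> ('m \<times> 'n \<Rightarrow> 'r) set" where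
  "map_to_tensor A C D e \<kappa> = (\<lambda>n r. if n = 0
     then (\<zero>\<^bsub>cobj (tensor_complex A C D) 0\<^esub>)(0 := pure_tensor A (cobj C 0) (cobj D 0) e (\<kappa> r))
     else \<zero>\<^bsub>cobj (tensor_complex A C D) n\<^esub>)"

text \<open>The Koszul complex: \<open>e\<^sub>I\<close>, for \<open>I \<subseteq> {0..<n}\<close> with \<open>i\<close> elements, is a basis of the term of
  homological degree \<open>i\<close>, that is, of cohomological degree \<open>-i\<close>, and
  \<open>d e\<^sub>I = \<Sum>\<^sub>j\<^sub>\<in>\<^sub>I (-1)\<^bsup>#{k\<in>I. k<j}\<^esup> x\<^sub>j e\<^bsub>I - {j}\<^esub>\<close>.\<close>

definition koszul_complex :: "('r, 'x) ring_scheme \<Rightarrow> 'r list \<Rightarrow> ('r, nat set \<Rightarrow> 'r) mod_complex" where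
  "koszul_complex A xs =
    \<lparr>cobj = (\<lambda>n. free_module A {I. I \<subseteq> {..<length xs} \<and> int (card I) = - n}),
     cdiff = (\<lambda>n f I. if I \<subseteq> {..<length xs} then
        finsum A (\<lambda>j. let y = xs ! j \<otimes>\<^bsub>A\<^esub> f (insert j I)
                      in if even (card {k \<in> I. k < j}) then y else \<ominus>\<^bsub>A\<^esub> y)
          ({..<length xs} - I)
        else \<zero>\<^bsub>A\<^esub>)\<rparr>"

text \<open>It suffices to test lifting against surjections onto \<open>M\<close> from the free module on \<open>M\<close>, so the
  types of the test modules are no restriction.\<close>

definition projective_module :: "('r, 'x) ring_scheme \<Rightarrow> ('r, 'm) module \<Rightarrow> bool" where
  "projective_module A M \<longleftrightarrow> module A M
     \<and> (\<forall>(X :: ('r, 'm \<Rightarrow> 'r) module) (Y :: ('r, 'm) module) p f.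
          module A X \<and> module A Y \<and> p \<in> mod_hom A X Y \<and> p ` carrier X = carrier Y
          \<and> f \<in> mod_hom A M Y
          \<longrightarrow> (\<exists>g\<in>mod_hom A M X. \<forall>x\<in>carrier M. p (g x) = f x))"

definition projective_resolution ::
  "('r, 'x) ring_scheme \<Rightarrow> ('r, 'n) module \<Rightarrow> ('r, 'm) mod_complex \<Rightarrow> ('m \<Rightarrow> 'n) \<Rightarrow> bool" where
  "projective_resolution A M P aug \<longleftrightarrow> is_complex A P
     \<and> (\<forall>n. projective_module A (cobj P n))
     \<and> (\<forall>n>0. carrier (cobj P n) = {\<zero>\<^bsub>cobj P n\<^esub>})
     \<and> quasi_iso A P (in_degree_zero M) (\<lambda>n. if n = 0 then aug else (\<lambda>x. \<zero>\<^bsub>M\<^esub>))"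

text \<open>By Baer's criterion, the types of the test modules are no restriction.\<close>

definition injective_module :: "('r, 'x) ring_scheme \<Rightarrow> ('r, 'm) module \<Rightarrow> bool" where
  "injective_module A M \<longleftrightarrow> module A M
     \<and> (\<forall>(X :: ('r, 'r) module) (Y :: ('r, 'r) module) i f.
          module A X \<and> module A Y \<and> i \<in> mod_hom A X Y \<and> inj_on i (carrier X)
          \<and> f \<in> mod_hom A X M
          \<longrightarrow> (\<exists>g\<in>mod_hom A Y M. \<forall>x\<in>carrier X. g (i x) = f x))"

definition hom_complex :: "('r, 'x) ring_scheme \<Rightarrow> ('r, 'm) mod_complex \<Rightarrow> ('r, 'n) mod_complex
    \<Rightarrow> ('r, int \<Rightarrow> 'm \<Rightarrow> 'n) mod_complex" where
  "hom_complex A C D =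
    \<lparr>cobj = (\<lambda>n.
      \<lparr>carrier = {f. \<forall>i. f i \<in> mod_hom A (cobj C i) (cobj D (i + n)) \<inter> extensional (carrier (cobj C i))},
       monoid.mult = undefined, one = undefined,
       zero = (\<lambda>i. \<lambda>x\<in>carrier (cobj C i). \<zero>\<^bsub>cobj D (i + n)\<^esub>),
       add = (\<lambda>f g i. \<lambda>x\<in>carrier (cobj C i). f i x \<oplus>\<^bsub>cobj D (i + n)\<^esub> g i x),
       smult = (\<lambda>r f i. \<lambda>x\<in>carrier (cobj C i). r \<odot>\<^bsub>cobj D (i + n)\<^esub> f i x)\<rparr>),
     cdiff = (\<lambda>n f i. \<lambda>x\<in>carrier (cobj C i).
       let u = cdiff D (i + n) (f i x); v = f (i + 1) (cdiff C i x)
       in if even n then u \<ominus>\<^bsub>cobj D (i + n + 1)\<^esub> v else u \<oplus>\<^bsub>cobj D (i + n + 1)\<^esub> v)\<rparr>"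

text \<open>A dualizing complex, represented by a bounded complex \<open>\<omega>\<close> of injective modules, so that
  \<open>RHom(\<omega>, \<omega>)\<close> is the Hom complex.  Over a Noetherian ring with infinitely many elements the
  indecomposable injectives, and the minimal representative of \<open>\<omega>\<close>, have at most the cardinality of
  the ring; hence the bound on the type of \<open>\<omega>\<close> is no restriction.\<close>

definition has_dualizing_complex :: "('r, 'x) ring_scheme \<Rightarrow> bool" where
  "has_dualizing_complex A \<longleftrightarrow> (\<exists>\<omega> :: ('r, nat \<Rightarrow> 'r) mod_complex.
     is_complex A \<omega> \<and> (\<forall>n. injective_module A (cobj \<omega> n))
     \<and> finite {n. carrier (cobj \<omega> n) \<noteq> {\<zero>\<^bsub>cobj \<omega> n\<^esub>}}
     \<and> (\<forall>n. \<exists>S. finite S \<and> S \<subseteq> cycles \<omega> n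
            \<and> mod_span A (cobj \<omega> n) (S \<union> boundaries \<omega> n) = cycles \<omega> n)
     \<and> quasi_iso A (ring_complex A) (hom_complex A \<omega> \<omega>)
         (\<lambda>n r. if n = 0 then (\<lambda>i. \<lambda>x\<in>carrier (cobj \<omega> i). r \<odot>\<^bsub>cobj \<omega> i\<^esub> x)
                else \<zero>\<^bsub>cobj (hom_complex A \<omega> \<omega>) n\<^esub>))"

section \<open>Schemes\<close>

record ('p, 's) rspace =
  sptop :: "'p topology"
  sec :: "'p set \<Rightarrow> 's ring"
  res :: "'p set \<Rightarrow> 'p set \<Rightarrow> 's \<Rightarrow> 's"

abbreviation pts :: "('p, 's, 'x) rspace_scheme \<Rightarrow> 'p set" where
  "pts X \<equiv> topspace (sptop X)"

definition ringed_space :: "('p, 's) rspace \<Rightarrow> bool" where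
  "ringed_space X \<longleftrightarrow>
     (\<forall>U. openin (sptop X) U \<longrightarrow> cring (sec X U) \<and> (\<forall>s\<in>carrier (sec X U). res X U U s = s))
     \<and> (\<forall>U V. openin (sptop X) U \<and> openin (sptop X) V \<and> V \<subseteq> U \<longrightarrow>
           res X U V \<in> ring_hom (sec X U) (sec X V))
     \<and> (\<forall>U V W. openin (sptop X) U \<and> openin (sptop X) V \<and> openin (sptop X) W \<and> W \<subseteq> V \<and> V \<subseteq> U
           \<longrightarrow> (\<forall>s\<in>carrier (sec X U). res X V W (res X U V s) = res X U W s))
     \<and> (\<forall>\<U> f. (\<forall>U\<in>\<U>. openin (sptop X) U \<and> f U \<in> carrier (sec X U))
           \<and> (\<forall>U\<in>\<U>. \<forall>V\<in>\<U>. res X U (U \<inter> V) (f U) = res X V (U \<inter> V) (f V))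
           \<longrightarrow> (\<exists>!s. s \<in> carrier (sec X (\<Union>\<U>)) \<and> (\<forall>U\<in>\<U>. res X (\<Union>\<U>) U s = f U)))"

definition germ :: "('p, 's) rspace \<Rightarrow> 'p \<Rightarrow> 'p set \<Rightarrow> 's \<Rightarrow> ('p set \<times> 's) set" where
  "germ X p U s = {(V, t). openin (sptop X) V \<and> p \<in> V \<and> t \<in> carrier (sec X V)
     \<and> (\<exists>W. openin (sptop X) W \<and> p \<in> W \<and> W \<subseteq> U \<inter> V \<and> res X U W s = res X V W t)}"

definition stalk :: "('p, 's) rspace \<Rightarrow> 'p \<Rightarrow> ('p set \<times> 's) set ring" where
  "stalk X p =
    \<lparr>carrier = {germ X p U s | U s. openin (sptop X) U \<and> p \<in> U \<and> s \<in> carrier (sec X U)},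
     monoid.mult = (\<lambda>a b. THE c. \<exists>U. openin (sptop X) U \<and> p \<in> U \<and> (\<exists>s\<in>carrier (sec X U). \<exists>t\<in>carrier (sec X U).
        a = germ X p U s \<and> b = germ X p U t \<and> c = germ X p U (s \<otimes>\<^bsub>sec X U\<^esub> t))),
     one = germ X p (pts X) \<one>\<^bsub>sec X (pts X)\<^esub>,
     zero = germ X p (pts X) \<zero>\<^bsub>sec X (pts X)\<^esub>,
     add = (\<lambda>a b. THE c. \<exists>U. openin (sptop X) U \<and> p \<in> U \<and> (\<exists>s\<in>carrier (sec X U). \<exists>t\<in>carrier (sec X U).
        a = germ X p U s \<and> b = germ X p U t \<and> c = germ X p U (s \<oplus>\<^bsub>sec X U\<^esub> t)))\<rparr>"

definition locally_ringed_space :: "('p, 's) rspace \<Rightarrow> bool" where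
  "locally_ringed_space X \<longleftrightarrow> ringed_space X \<and> (\<forall>p\<in>pts X. local_ring (stalk X p))"

definition open_sub :: "('p, 's) rspace \<Rightarrow> 'p set \<Rightarrow> ('p, 's) rspace" where
  "open_sub X U = X\<lparr>sptop := subtopology (sptop X) U\<rparr>"

record ('x, 'a, 'y, 'b) mor =
  pt :: "'x \<Rightarrow> 'y"
  comorph :: "'y set \<Rightarrow> 'b \<Rightarrow> 'a"

definition preim :: "('x, 'a) rspace \<Rightarrow> ('x, 'a, 'y, 'b) mor \<Rightarrow> 'y set \<Rightarrow> 'x set" where
  "preim X f V = {x \<in> pts X. pt f x \<in> V}"

text \<open>Morphisms of locally ringed spaces; the last clause is locality of the stalk maps.\<close>

definition morphism :: "('x, 'a) rspace \<Rightarrow> ('y, 'b) rspace \<Rightarrow> ('x, 'a, 'y, 'b) mor \<Rightarrow> bool" where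
  "morphism X Y f \<longleftrightarrow> continuous_map (sptop X) (sptop Y) (pt f)
     \<and> (\<forall>V. openin (sptop Y) V \<longrightarrow> comorph f V \<in> ring_hom (sec Y V) (sec X (preim X f V)))
     \<and> (\<forall>V W. openin (sptop Y) V \<and> openin (sptop Y) W \<and> W \<subseteq> V \<longrightarrow> (\<forall>t\<in>carrier (sec Y V).
          res X (preim X f V) (preim X f W) (comorph f V t) = comorph f W (res Y V W t)))
     \<and> (\<forall>x\<in>pts X. \<forall>V. openin (sptop Y) V \<and> pt f x \<in> V \<longrightarrow> (\<forall>t\<in>carrier (sec Y V).
          germ X x (preim X f V) (comorph f V t) \<in> Units (stalk X x)
          \<longrightarrow> germ Y (pt f x) V t \<in> Units (stalk Y (pt f x))))"

definition mor_id :: "('x, 'a, 'x, 'a) mor" where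
  "mor_id = \<lparr>pt = (\<lambda>x. x), comorph = (\<lambda>V t. t)\<rparr>"

text \<open>The composite \<open>g \<circ> f\<close>, with \<open>Y\<close> the source of \<open>g\<close>.\<close>

definition mor_comp :: "('y, 'b) rspace \<Rightarrow> ('y, 'b, 'z, 'c) mor \<Rightarrow> ('x, 'a, 'y, 'b) mor
    \<Rightarrow> ('x, 'a, 'z, 'c) mor" where
  "mor_comp Y g f = \<lparr>pt = pt g \<circ> pt f, comorph = (\<lambda>V. comorph f (preim Y g V) \<circ> comorph g V)\<rparr>"

text \<open>Equality of morphisms \<open>X \<rightarrow> Y\<close>, disregarding values outside the carriers.\<close>

definition mor_eq :: "('x, 'a) rspace \<Rightarrow> ('y, 'b) rspace \<Rightarrow> ('x, 'a, 'y, 'b) mor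
    \<Rightarrow> ('x, 'a, 'y, 'b) mor \<Rightarrow> bool" where
  "mor_eq X Y f g \<longleftrightarrow> (\<forall>x\<in>pts X. pt f x = pt g x)
     \<and> (\<forall>V. openin (sptop Y) V \<longrightarrow> (\<forall>t\<in>carrier (sec Y V). comorph f V t = comorph g V t))"

definition isomorphism :: "('x, 'a) rspace \<Rightarrow> ('y, 'b) rspace \<Rightarrow> ('x, 'a, 'y, 'b) mor \<Rightarrow> bool" where
  "isomorphism X Y f \<longleftrightarrow> morphism X Y f \<and> (\<exists>g. morphism Y X g
     \<and> mor_eq X X (mor_comp Y g f) mor_id \<and> mor_eq Y Y (mor_comp X f g) mor_id)"

definition Spec :: "('a, 'x) ring_scheme \<Rightarrow> ('a set, 'a set \<Rightarrow> ('a \<times> 'a) set) rspace" where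
  "Spec A =
    \<lparr>sptop = spec_topology A,
     sec = (\<lambda>U.
      \<lparr>carrier = {s \<in> (\<Pi>\<^sub>E p\<in>U. carrier (localization_at A p)).
          \<forall>p\<in>U. \<exists>V. openin (spec_topology A) V \<and> p \<in> V \<and> V \<subseteq> U
            \<and> (\<exists>a\<in>carrier A. \<exists>f\<in>carrier A. \<forall>q\<in>V. f \<notin> q \<and> s q = frac A (carrier A - q) a f)},
       monoid.mult = (\<lambda>s t. \<lambda>p\<in>U. s p \<otimes>\<^bsub>localization_at A p\<^esub> t p),
       one = (\<lambda>p\<in>U. \<one>\<^bsub>localization_at A p\<^esub>),
       zero = (\<lambda>p\<in>U. \<zero>\<^bsub>localization_at A p\<^esub>),
       add = (\<lambda>s t. \<lambda>p\<in>U. s p \<oplus>\<^bsub>localization_at A p\<^esub> t p)\<rparr>),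
     res = (\<lambda>U V s. restrict s V)\<rparr>"

text \<open>The structure map \<open>A \<rightarrow> \<Gamma>(X, O\<^sub>X)\<close> of a morphism \<open>f : X \<rightarrow> Spec A\<close>.\<close>

definition structure_map :: "('a, 'm) ring_scheme
    \<Rightarrow> ('x, 's, 'a set, 'a set \<Rightarrow> ('a \<times> 'a) set) mor \<Rightarrow> 'a \<Rightarrow> 's" where
  "structure_map A f r =
     comorph f (prime_ideals A) (\<lambda>p\<in>prime_ideals A. frac A (carrier A - p) r \<one>\<^bsub>A\<^esub>)"

text \<open>If \<open>X\<close> is isomorphic to \<open>Spec A\<close>, then \<open>A\<close> is isomorphic to the ring of global sections, so
  \<open>A\<close> may be taken on the type of sections of \<open>X\<close>.\<close>

definition affine_scheme :: "('p, 's) rspace \<Rightarrow> bool" where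
  "affine_scheme X \<longleftrightarrow> (\<exists>(A :: 's ring) f. cring A \<and> isomorphism X (Spec A) f)"

definition affine_open :: "('p, 's) rspace \<Rightarrow> 'p set \<Rightarrow> bool" where
  "affine_open X U \<longleftrightarrow> openin (sptop X) U \<and> affine_scheme (open_sub X U)"

definition is_scheme :: "('p, 's) rspace \<Rightarrow> bool" where
  "is_scheme X \<longleftrightarrow> locally_ringed_space X \<and> (\<forall>x\<in>pts X. \<exists>U. affine_open X U \<and> x \<in> U)"

definition integral_scheme :: "('p, 's) rspace \<Rightarrow> bool" where
  "integral_scheme X \<longleftrightarrow> is_scheme X \<and> pts X \<noteq> {}
     \<and> (\<forall>U. openin (sptop X) U \<and> U \<noteq> {} \<longrightarrow> domain (sec X U))"

definition nonsingular :: "('p, 's) rspace \<Rightarrow> bool" where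
  "nonsingular X \<longleftrightarrow> (\<forall>x\<in>pts X. regular_local_ring (stalk X x))"

subsection \<open>Proper birational morphisms\<close>

definition finite_type_hom :: "('a, 'x) ring_scheme \<Rightarrow> ('b, 'y) ring_scheme \<Rightarrow> ('a \<Rightarrow> 'b) \<Rightarrow> bool" where
  "finite_type_hom A B \<phi> \<longleftrightarrow> \<phi> \<in> ring_hom A B
     \<and> (\<exists>S. finite S \<and> S \<subseteq> carrier B \<and> generate_ring B (\<phi> ` carrier A \<union> S) = carrier B)"

definition finite_type :: "('x, 'a) rspace \<Rightarrow> ('y, 'b) rspace \<Rightarrow> ('x, 'a, 'y, 'b) mor \<Rightarrow> bool" where
  "finite_type X Y f \<longleftrightarrow>
     (\<forall>V. openin (sptop Y) V \<and> compactin (sptop Y) V \<longrightarrow> compactin (sptop X) (preim X f V))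
     \<and> (\<forall>x\<in>pts X. \<exists>U V. affine_open X U \<and> affine_open Y V \<and> x \<in> U \<and> pt f ` U \<subseteq> V
          \<and> finite_type_hom (sec Y V) (sec X U) (\<lambda>t. res X (preim X f V) U (comorph f V t)))"

text \<open>Types that serve as universes: the fibre product of two schemes, built from the stalks, and the
  affine spaces over a scheme fit (up to isomorphism) into the universe over the product of the types
  of their points and sections.\<close>

type_synonym 't univ = "('t \<times> nat) set set set set"

text \<open>The universal property of \<open>W = X \<times>\<^sub>S Y\<close>; the test schemes range over the types of \<open>W\<close>, which is
  enough as soon as a fibre product exists on these types (test with open subschemes of it).\<close>

definition fibre_product :: "('x, 'a) rspace \<Rightarrow> ('y, 'b) rspace \<Rightarrow> ('s, 'c) rspace
    \<Rightarrow> ('x, 'a, 's, 'c) mor \<Rightarrow> ('y, 'b, 's, 'c) mor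
    \<Rightarrow> ('w, 'd) rspace \<Rightarrow> ('w, 'd, 'x, 'a) mor \<Rightarrow> ('w, 'd, 'y, 'b) mor \<Rightarrow> bool" where
  "fibre_product X Y S f g W p q \<longleftrightarrow> is_scheme W \<and> morphism W X p \<and> morphism W Y q
     \<and> mor_eq W S (mor_comp X f p) (mor_comp Y g q)
     \<and> (\<forall>(T :: ('w, 'd) rspace) a b. is_scheme T \<and> morphism T X a \<and> morphism T Y b
          \<and> mor_eq T S (mor_comp X f a) (mor_comp Y g b) \<longrightarrow>
          (\<exists>h. morphism T W h \<and> mor_eq T X (mor_comp W p h) a \<and> mor_eq T Y (mor_comp W q h) b
             \<and> (\<forall>h'. morphism T W h' \<and> mor_eq T X (mor_comp W p h') a
                    \<and> mor_eq T Y (mor_comp W q h') b \<longrightarrow> mor_eq T W h' h)))"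

definition closed_immersion :: "('x, 'a) rspace \<Rightarrow> ('y, 'b) rspace \<Rightarrow> ('x, 'a, 'y, 'b) mor \<Rightarrow> bool" where
  "closed_immersion X Y f \<longleftrightarrow> morphism X Y f \<and> embedding_map (sptop X) (sptop Y) (pt f)
     \<and> closedin (sptop Y) (pt f ` pts X)
     \<and> (\<forall>x\<in>pts X. \<forall>c\<in>carrier (stalk X x). \<exists>V t. openin (sptop Y) V \<and> pt f x \<in> V
          \<and> t \<in> carrier (sec Y V) \<and> c = germ X x (preim X f V) (comorph f V t))"

definition separated :: "('x, 'a) rspace \<Rightarrow> ('y, 'b) rspace \<Rightarrow> ('x, 'a, 'y, 'b) mor \<Rightarrow> bool" where
  "separated X Y f \<longleftrightarrow>
     (\<forall>(W :: (('x \<times> 'a \<times> 'y \<times> 'b) univ, ('x \<times> 'a \<times> 'y \<times> 'b) univ) rspace) p q \<Delta>.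
        fibre_product X X Y f f W p q \<and> morphism X W \<Delta>
        \<and> mor_eq X X (mor_comp W p \<Delta>) mor_id \<and> mor_eq X X (mor_comp W q \<Delta>) mor_id
        \<longrightarrow> closed_immersion X W \<Delta>)"

text \<open>For \<open>f\<close> quasi-compact, closedness of the base changes to the affine spaces over \<open>Y\<close> implies
  closedness of all base changes; hence the bound on the types of \<open>Y'\<close> is no restriction.\<close>

definition universally_closed :: "('x, 'a) rspace \<Rightarrow> ('y, 'b) rspace \<Rightarrow> ('x, 'a, 'y, 'b) mor \<Rightarrow> bool" where
  "universally_closed X Y f \<longleftrightarrow>
     (\<forall>(Y' :: (('y \<times> 'b) univ, ('y \<times> 'b) univ) rspace) g
       (W :: (('x \<times> 'a \<times> ('y \<times> 'b) univ) univ, ('x \<times> 'a \<times> ('y \<times> 'b) univ) univ) rspace) p q.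
        is_scheme Y' \<and> morphism Y' Y g \<and> fibre_product X Y' Y f g W p q
        \<longrightarrow> closed_map (sptop W) (sptop Y') (pt q))"

definition proper_morphism :: "('x, 'a) rspace \<Rightarrow> ('y, 'b) rspace \<Rightarrow> ('x, 'a, 'y, 'b) mor \<Rightarrow> bool" where
  "proper_morphism X Y f \<longleftrightarrow>
     morphism X Y f \<and> finite_type X Y f \<and> separated X Y f \<and> universally_closed X Y f"

definition mor_restrict :: "('x, 'a) rspace \<Rightarrow> ('x, 'a, 'y, 'b) mor \<Rightarrow> 'x set \<Rightarrow> ('x, 'a, 'y, 'b) mor" where
  "mor_restrict X f U = \<lparr>pt = pt f,
     comorph = (\<lambda>V t. res X (preim X f V) (preim X f V \<inter> U) (comorph f V t))\<rparr>"

definition iso_onto :: "('x, 'a) rspace \<Rightarrow> ('y, 'b) rspace \<Rightarrow> ('x, 'a, 'y, 'b) mor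
    \<Rightarrow> 'x set \<Rightarrow> 'y set \<Rightarrow> bool" where
  "iso_onto X Y f U V \<longleftrightarrow> openin (sptop X) U \<and> openin (sptop Y) V
     \<and> isomorphism (open_sub X U) (open_sub Y V) (mor_restrict X f U)"

text \<open>For integral schemes.\<close>

definition birational :: "('x, 'a) rspace \<Rightarrow> ('y, 'b) rspace \<Rightarrow> ('x, 'a, 'y, 'b) mor \<Rightarrow> bool" where
  "birational X Y f \<longleftrightarrow> morphism X Y f \<and> (\<exists>U V. U \<noteq> {} \<and> V \<noteq> {} \<and> iso_onto X Y f U V)"

text \<open>The complement of the largest open subset on which \<open>f\<close> is locally an isomorphism onto an open
  subset of \<open>Y\<close>.\<close>

definition exceptional_set :: "('x, 'a) rspace \<Rightarrow> ('y, 'b) rspace \<Rightarrow> ('x, 'a, 'y, 'b) mor \<Rightarrow> 'x set" where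
  "exceptional_set X Y f = {x \<in> pts X. \<not> (\<exists>U V. x \<in> U \<and> iso_onto X Y f U V)}"

subsection \<open>Divisors\<close>

definition generic_point :: "('p, 's) rspace \<Rightarrow> 'p" where
  "generic_point X = (THE \<xi>. \<xi> \<in> pts X \<and> (\<forall>U. openin (sptop X) U \<and> U \<noteq> {} \<longrightarrow> \<xi> \<in> U))"

abbreviation function_field :: "('p, 's) rspace \<Rightarrow> ('p set \<times> 's) set ring" where
  "function_field X \<equiv> stalk X (generic_point X)"

text \<open>The canonical map from the stalk at \<open>p\<close> to the function field.\<close>

definition to_function_field :: "('p, 's) rspace \<Rightarrow> 'p \<Rightarrow> ('p set \<times> 's) set \<Rightarrow> ('p set \<times> 's) set" where
  "to_function_field X p c = (THE k. \<exists>U s. openin (sptop X) U \<and> p \<in> U \<and> s \<in> carrier (sec X U)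
     \<and> c = germ X p U s \<and> k = germ X (generic_point X) U s)"

text \<open>Prime divisors are represented by their generic points.\<close>

definition prime_divisors :: "('p, 's) rspace \<Rightarrow> 'p set" where
  "prime_divisors X = {\<eta> \<in> pts X. krull_dim (stalk X \<eta>) = 1}"

definition divisor_supp :: "('p \<Rightarrow> int) \<Rightarrow> 'p set" where
  "divisor_supp D = {\<eta>. D \<eta> \<noteq> 0}"

definition is_divisor :: "('p, 's) rspace \<Rightarrow> ('p \<Rightarrow> int) \<Rightarrow> bool" where
  "is_divisor X D \<longleftrightarrow> finite (divisor_supp D) \<and> divisor_supp D \<subseteq> prime_divisors X"

text \<open>The order of a nonzero rational function along a prime divisor at which \<open>X\<close> is regular:
  \<open>f = u \<tau>\<^sup>n\<close> with \<open>\<tau>\<close> a uniformizer and \<open>u\<close> a unit of the stalk.\<close>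

definition ord_at :: "('p, 's) rspace \<Rightarrow> 'p \<Rightarrow> ('p set \<times> 's) set \<Rightarrow> int" where
  "ord_at X \<eta> f = (THE n. \<exists>\<tau>\<in>carrier (stalk X \<eta>). \<exists>u\<in>Units (stalk X \<eta>).
     genideal (stalk X \<eta>) {\<tau>} = max_ideal (stalk X \<eta>)
     \<and> f = to_function_field X \<eta> u
           \<otimes>\<^bsub>function_field X\<^esub> (to_function_field X \<eta> \<tau> [^]\<^bsub>function_field X\<^esub> n))"

record ('p, 's, 'm) msheaf =
  msec :: "'p set \<Rightarrow> ('s, 'm) module"
  mres :: "'p set \<Rightarrow> 'p set \<Rightarrow> 'm \<Rightarrow> 'm"

text \<open>\<open>O\<^sub>X(D)\<close> as a sheaf of submodules of the function field of an integral, regular scheme.\<close>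

definition divisor_sheaf ::
  "('p, 's) rspace \<Rightarrow> ('p \<Rightarrow> int) \<Rightarrow> ('p, 's, ('p set \<times> 's) set) msheaf" where
  "divisor_sheaf X D = (let K = function_field X in
    \<lparr>msec = (\<lambda>U.
      \<lparr>carrier = (if U = {} then {\<zero>\<^bsub>K\<^esub>} else
          {f \<in> carrier K. f \<noteq> \<zero>\<^bsub>K\<^esub> \<longrightarrow> (\<forall>\<eta>\<in>U \<inter> prime_divisors X. ord_at X \<eta> f \<ge> - D \<eta>)}),
       monoid.mult = monoid.mult K, one = one K, zero = zero K, add = add K,
       smult = (\<lambda>s f. if U = {} then \<zero>\<^bsub>K\<^esub> else germ X (generic_point X) U s \<otimes>\<^bsub>K\<^esub> f)\<rparr>),
     mres = (\<lambda>U V f. if V = {} then \<zero>\<^bsub>K\<^esub> else f)\<rparr>)"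

definition extended_ideal_stalk :: "('a, 'm) ring_scheme \<Rightarrow> ('x, 's) rspace
    \<Rightarrow> ('x, 's, 'a set, 'a set \<Rightarrow> ('a \<times> 'a) set) mor \<Rightarrow> 'a set \<Rightarrow> 'x \<Rightarrow> ('x set \<times> 's) set set" where
  "extended_ideal_stalk A X f I x =
     genideal (stalk X x) ((\<lambda>r. germ X x (pts X) (structure_map A f r)) ` I)"

text \<open>The equality \<open>I O\<^sub>X = O\<^sub>X(-D)\<close> of subsheaves of the constant sheaf of rational functions.\<close>

definition extended_ideal_eq :: "('a, 'm) ring_scheme \<Rightarrow> ('x, 's) rspace
    \<Rightarrow> ('x, 's, 'a set, 'a set \<Rightarrow> ('a \<times> 'a) set) mor \<Rightarrow> 'a set \<Rightarrow> ('x \<Rightarrow> int) \<Rightarrow> bool" where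
  "extended_ideal_eq A X f I D \<longleftrightarrow> (\<forall>U. openin (sptop X) U \<and> U \<noteq> {} \<longrightarrow>
     germ X (generic_point X) U
       ` {s \<in> carrier (sec X U). \<forall>x\<in>U. germ X x U s \<in> extended_ideal_stalk A X f I x}
     = carrier (msec (divisor_sheaf X (\<lambda>\<eta>. - D \<eta>)) U))"

text \<open>The ideal in the stalk at \<open>x\<close> of the prime divisor with generic point \<open>\<eta>\<close>.\<close>

definition prime_divisor_ideal :: "('p, 's) rspace \<Rightarrow> 'p \<Rightarrow> 'p \<Rightarrow> ('p set \<times> 's) set set" where
  "prime_divisor_ideal X \<eta> x = {germ X x U s | U s. openin (sptop X) U \<and> x \<in> U
     \<and> s \<in> carrier (sec X U) \<and> germ X \<eta> U s \<in> max_ideal (stalk X \<eta>)}"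

text \<open>The reduced divisor with components \<open>T\<close> has simple normal crossings: at each point, the components
  through it are cut out by distinct members of a regular system of parameters.\<close>

definition snc :: "('p, 's) rspace \<Rightarrow> 'p set \<Rightarrow> bool" where
  "snc X T \<longleftrightarrow> finite T \<and> T \<subseteq> prime_divisors X
     \<and> (\<forall>x\<in>pts X. let Tx = {\<eta>\<in>T. x \<in> sptop X closure_of {\<eta>}} in
          \<exists>zs idx. regular_parameters (stalk X x) zs \<and> inj_on idx Tx
            \<and> (\<forall>\<eta>\<in>Tx. idx \<eta> < length zs
                 \<and> prime_divisor_ideal X \<eta> x = genideal (stalk X x) {zs ! idx \<eta>}))"

text \<open>Effectivity of \<open>D\<close> is implied by \<open>O\<^sub>Z(-D) = I O\<^sub>Z \<subseteq> O\<^sub>Z\<close>; it is recorded because the canonical map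
  \<open>O\<^sub>Z \<rightarrow> O\<^sub>Z(\<lfloor>tD\<rfloor>)\<close> relies on it.\<close>

definition log_resolution :: "('a, 'm) ring_scheme \<Rightarrow> 'a set \<Rightarrow> ('z, 's) rspace
    \<Rightarrow> ('z, 's, 'a set, 'a set \<Rightarrow> ('a \<times> 'a) set) mor \<Rightarrow> ('z \<Rightarrow> int) \<Rightarrow> bool" where
  "log_resolution A I Z \<pi> D \<longleftrightarrow>
     integral_scheme Z \<and> nonsingular Z
     \<and> proper_morphism Z (Spec A) \<pi> \<and> birational Z (Spec A) \<pi>
     \<and> is_divisor Z D \<and> (\<forall>\<eta>. 0 \<le> D \<eta>) \<and> extended_ideal_eq A Z \<pi> I D \<and> snc Z (divisor_supp D)
     \<and> (\<exists>T. finite T \<and> T \<subseteq> prime_divisors Z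
          \<and> exceptional_set Z (Spec A) \<pi> = (\<Union>\<eta>\<in>T. sptop Z closure_of {\<eta>})
          \<and> snc Z (T \<union> divisor_supp D))"

definition round_down_mult :: "real \<Rightarrow> ('z \<Rightarrow> int) \<Rightarrow> 'z \<Rightarrow> int" where
  "round_down_mult t D = (\<lambda>\<eta>. \<lfloor>t * of_int (D \<eta>)\<rfloor>)"

subsection \<open>Derived global sections\<close>

definition module_sheaf :: "('p, 's) rspace \<Rightarrow> ('p, 's, 'm) msheaf \<Rightarrow> bool" where
  "module_sheaf X F \<longleftrightarrow>
     (\<forall>U. openin (sptop X) U \<longrightarrow> module (sec X U) (msec F U)
        \<and> (\<forall>s\<in>carrier (msec F U). mres F U U s = s))
     \<and> (\<forall>U V. openin (sptop X) U \<and> openin (sptop X) V \<and> V \<subseteq> U \<longrightarrow>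
          mres F U V \<in> mod_hom (sec X U) (msec F U) (restrict_scalars (res X U V) (msec F V)))
     \<and> (\<forall>U V W. openin (sptop X) U \<and> openin (sptop X) V \<and> openin (sptop X) W \<and> W \<subseteq> V \<and> V \<subseteq> U
          \<longrightarrow> (\<forall>s\<in>carrier (msec F U). mres F V W (mres F U V s) = mres F U W s))
     \<and> (\<forall>\<U> f. (\<forall>U\<in>\<U>. openin (sptop X) U \<and> f U \<in> carrier (msec F U))
          \<and> (\<forall>U\<in>\<U>. \<forall>V\<in>\<U>. mres F U (U \<inter> V) (f U) = mres F V (U \<inter> V) (f V))
          \<longrightarrow> (\<exists>!s. s \<in> carrier (msec F (\<Union>\<U>)) \<and> (\<forall>U\<in>\<U>. mres F (\<Union>\<U>) U s = f U)))"

definition sheaf_hom :: "('p, 's) rspace \<Rightarrow> ('p, 's, 'm) msheaf \<Rightarrow> ('p, 's, 'n) msheaf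
    \<Rightarrow> ('p set \<Rightarrow> 'm \<Rightarrow> 'n) set" where
  "sheaf_hom X F G = {\<phi>.
     (\<forall>U. openin (sptop X) U \<longrightarrow> \<phi> U \<in> mod_hom (sec X U) (msec F U) (msec G U))
     \<and> (\<forall>U V. openin (sptop X) U \<and> openin (sptop X) V \<and> V \<subseteq> U \<longrightarrow>
          (\<forall>s\<in>carrier (msec F U). \<phi> V (mres F U V s) = mres G U V (\<phi> U s)))}"

text \<open>Injective objects in the category of \<open>O\<^sub>X\<close>-modules.  By Baer's criterion for the generators
  \<open>j\<^sub>!O\<^sub>U\<close>, whose sections are sections of \<open>O\<^sub>X\<close>, the types of the test sheaves are no restriction.\<close>

definition injective_sheaf :: "('p, 's) rspace \<Rightarrow> ('p, 's, 'm) msheaf \<Rightarrow> bool" where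
  "injective_sheaf X I \<longleftrightarrow> module_sheaf X I
     \<and> (\<forall>(F :: ('p, 's, 's) msheaf) (G :: ('p, 's, 's) msheaf) i f.
          module_sheaf X F \<and> module_sheaf X G \<and> i \<in> sheaf_hom X F G
          \<and> (\<forall>U. openin (sptop X) U \<longrightarrow> inj_on (i U) (carrier (msec F U)))
          \<and> f \<in> sheaf_hom X F I
          \<longrightarrow> (\<exists>g\<in>sheaf_hom X G I. \<forall>U. openin (sptop X) U \<longrightarrow>
                 (\<forall>s\<in>carrier (msec F U). g U (i U s) = f U s)))"

text \<open>Exactness of \<open>F \<rightarrow> G \<rightarrow> H\<close> at \<open>G\<close>, as sheaves.\<close>

definition sheaf_exact :: "('p, 's) rspace \<Rightarrow> ('p, 's, 'k) msheaf \<Rightarrow> ('p, 's, 'm) msheaf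
    \<Rightarrow> ('p, 's, 'n) msheaf \<Rightarrow> ('p set \<Rightarrow> 'k \<Rightarrow> 'm) \<Rightarrow> ('p set \<Rightarrow> 'm \<Rightarrow> 'n) \<Rightarrow> bool" where
  "sheaf_exact X F G H \<phi> \<psi> \<longleftrightarrow> (\<forall>U. openin (sptop X) U \<longrightarrow>
     (\<forall>s\<in>carrier (msec F U). \<psi> U (\<phi> U s) = \<zero>\<^bsub>msec H U\<^esub>)
     \<and> (\<forall>s\<in>carrier (msec G U). \<psi> U s = \<zero>\<^bsub>msec H U\<^esub> \<longrightarrow>
          (\<forall>x\<in>U. \<exists>V. openin (sptop X) V \<and> x \<in> V \<and> V \<subseteq> U
             \<and> (\<exists>t\<in>carrier (msec F V). \<phi> V t = mres G U V s))))"

record ('p, 's, 'k, 'm) sheaf_resolution =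
  robj :: "nat \<Rightarrow> ('p, 's, 'm) msheaf"
  rdiff :: "nat \<Rightarrow> 'p set \<Rightarrow> 'm \<Rightarrow> 'm"
  raug :: "'p set \<Rightarrow> 'k \<Rightarrow> 'm"

text \<open>An injective resolution \<open>0 \<rightarrow> F \<rightarrow> I\<^sup>0 \<rightarrow> I\<^sup>1 \<rightarrow> \<dots>\<close>.\<close>

definition injective_resolution ::
  "('p, 's) rspace \<Rightarrow> ('p, 's, 'k) msheaf \<Rightarrow> ('p, 's, 'k, 'm) sheaf_resolution \<Rightarrow> bool" where
  "injective_resolution X F I \<longleftrightarrow> module_sheaf X F
     \<and> (\<forall>n. injective_sheaf X (robj I n))
     \<and> raug I \<in> sheaf_hom X F (robj I 0)
     \<and> (\<forall>n. rdiff I n \<in> sheaf_hom X (robj I n) (robj I (Suc n)))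
     \<and> (\<forall>U. openin (sptop X) U \<longrightarrow> inj_on (raug I U) (carrier (msec F U)))
     \<and> sheaf_exact X F (robj I 0) (robj I 1) (raug I) (rdiff I 0)
     \<and> (\<forall>n. sheaf_exact X (robj I n) (robj I (Suc n)) (robj I (Suc (Suc n)))
              (rdiff I n) (rdiff I (Suc n)))"

text \<open>\<open>R\<Gamma>(Z, F)\<close>, computed by the injective resolution \<open>I\<close> of \<open>F\<close>, as a complex of \<open>A\<close>-modules.\<close>

definition RGamma :: "('a, 'm) ring_scheme \<Rightarrow> ('z, 's) rspace
    \<Rightarrow> ('z, 's, 'a set, 'a set \<Rightarrow> ('a \<times> 'a) set) mor
    \<Rightarrow> ('z, 's, 'k, 'v) sheaf_resolution \<Rightarrow> ('a, 'v) mod_complex" where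
  "RGamma A Z \<pi> I = (let M = (\<lambda>n. restrict_scalars (structure_map A \<pi>) (msec (robj I n) (pts Z))) in
    \<lparr>cobj = (\<lambda>n. if n < 0 then zero_submodule (M 0) else M (nat n)),
     cdiff = (\<lambda>n x. if n < 0 then \<zero>\<^bsub>M 0\<^esub> else rdiff I (nat n) (pts Z) x)\<rparr>)"

text \<open>The map \<open>A \<rightarrow> \<Gamma>(Z, O\<^sub>Z) \<rightarrow> \<Gamma>(Z, O\<^sub>Z(E)) \<rightarrow> \<Gamma>(Z, I\<^sup>0)\<close>, for \<open>E \<ge> 0\<close> and \<open>I\<close> a resolution of
  \<open>O\<^sub>Z(E)\<close>; it represents \<open>A \<rightarrow> R\<Gamma>(Z, O\<^sub>Z) \<rightarrow> R\<Gamma>(Z, O\<^sub>Z(E))\<close>.\<close>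

definition map_to_RGamma :: "('a, 'm) ring_scheme \<Rightarrow> ('z, 's) rspace
    \<Rightarrow> ('z, 's, 'a set, 'a set \<Rightarrow> ('a \<times> 'a) set) mor
    \<Rightarrow> ('z, 's, ('z set \<times> 's) set, 'v) sheaf_resolution \<Rightarrow> 'a \<Rightarrow> 'v" where
  "map_to_RGamma A Z \<pi> I r =
     raug I (pts Z) (germ Z (generic_point Z) (pts Z) (structure_map A \<pi> r))"

section \<open>The thresholds\<close>

definition quotient_module :: "('a, 'm) ring_scheme \<Rightarrow> 'a set \<Rightarrow> ('a, 'a set) module" where
  "quotient_module A J = alg_module (\<lambda>r. J +>\<^bsub>A\<^esub> r) (A Quot J)"

text \<open>\<open>Res\<close> assigns to each sheaf \<open>O\<^sub>Z(E)\<close> an injective resolution, and \<open>P\<close> is a projective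
  resolution of \<open>A/J\<close> with augmentation \<open>aug\<close>; they compute \<open>R\<Gamma>\<close> and \<open>A/J \<otimes>\<^sup>L _\<close>.  The map
  \<open>A \<rightarrow> A/J\<close> is lifted to \<open>A \<rightarrow> P\<close>, \<open>r \<mapsto> r e\<close>, for a preimage \<open>e\<close> of \<open>1\<close>; any two such lifts are
  homotopic.\<close>

definition Hir_set :: "('a, 'x) ring_scheme \<Rightarrow> ('z, 's) rspace
    \<Rightarrow> ('z, 's, 'a set, 'a set \<Rightarrow> ('a \<times> 'a) set) mor \<Rightarrow> ('z \<Rightarrow> int) \<Rightarrow> 'a set
    \<Rightarrow> ('a, 'q) mod_complex \<Rightarrow> ('q \<Rightarrow> 'a set)
    \<Rightarrow> (('z, 's, ('z set \<times> 's) set) msheaf \<Rightarrow> ('z, 's, ('z set \<times> 's) set, 'v) sheaf_resolution)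
    \<Rightarrow> real set" where
  "Hir_set A Z \<pi> D J P aug Res = {t. t \<ge> 0 \<and>
     (let I = Res (divisor_sheaf Z (round_down_mult t D));
          C = RGamma A Z \<pi> I;
          e = (SOME e. e \<in> carrier (cobj P 0) \<and> aug e = \<one>\<^bsub>A Quot J\<^esub>)
      in zero_in_derived_category A (ring_complex A) (tensor_complex A P C)
           (map_to_tensor A P C e (map_to_RGamma A Z \<pi> I)))}"

text \<open>The Koszul complex is a bounded complex of free modules, so no resolution of it is needed.\<close>

definition KH_set :: "('a, 'x) ring_scheme \<Rightarrow> ('z, 's) rspace
    \<Rightarrow> ('z, 's, 'a set, 'a set \<Rightarrow> ('a \<times> 'a) set) mor \<Rightarrow> ('z \<Rightarrow> int) \<Rightarrow> 'a list
    \<Rightarrow> (('z, 's, ('z set \<times> 's) set) msheaf \<Rightarrow> ('z, 's, ('z set \<times> 's) set, 'v) sheaf_resolution)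
    \<Rightarrow> real set" where
  "KH_set A Z \<pi> D xs Res = {t. t \<ge> 0 \<and>
     (let I = Res (divisor_sheaf Z (round_down_mult t D));
          C = RGamma A Z \<pi> I;
          P = koszul_complex A xs
      in zero_in_derived_category A (ring_complex A) (tensor_complex A P C)
           (map_to_tensor A P C (indicator_elt A {}) (map_to_RGamma A Z \<pi> I)))}"

text \<open>Infima in the extended reals, so that the threshold is \<open>\<infinity>\<close> if the set is empty.\<close>

definition c_Hir where
  "c_Hir A Z \<pi> D J P aug Res = (INF t\<in>Hir_set A Z \<pi> D J P aug Res. ereal t)"

definition c_KH where
  "c_KH A Z \<pi> D xs Res = (INF t\<in>KH_set A Z \<pi> D xs Res. ereal t)"

definition is_minimum :: "real set \<Rightarrow> ereal \<Rightarrow> bool" where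
  "is_minimum S c \<longleftrightarrow> (\<exists>t\<in>S. c = ereal t \<and> (\<forall>s\<in>S. t \<le> s))"

end

theory Submission
  imports Defs
begin

text \<open>Membership of \<open>t\<close> in either set depends only on the rounded divisor \<open>\<lfloor>tD\<rfloor>\<close>.  As \<open>D\<close> is effective
  with finite support, \<open>\<lfloor>sD\<rfloor> = \<lfloor>tD\<rfloor>\<close> for all \<open>s \<ge> t\<close> close to \<open>t\<close>; so the infimum \<open>t\<close> of the set, being
  a limit of elements \<open>s \<ge> t\<close> of the set, belongs to it.\<close>

text \<open>The floor function is right-continuous, and \<open>k \<ge> 0\<close> ensures that
  \<open>s * k\<close> approaches \<open>t * k\<close> from above as \<open>s\<close> decreases to
  \<open>t\<close>.\<close>

lemma floor_mult_eventually_const_at_right: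
  fixes k :: int and t :: real
  assumes "k \<ge> 0"
  shows "\<forall>\<^sub>F s in at_right t. \<lfloor>s * of_int k\<rfloor> = \<lfloor>t * of_int k\<rfloor>"
proof -
  have "((\<lambda>s. s * of_int k) \<longlongrightarrow> t * of_int k) (at_right t)"
    by (intro tendsto_intros)
  then have "\<forall>\<^sub>F s in at_right t. s * of_int k < of_int \<lfloor>t * of_int k\<rfloor> + 1"
    by (rule order_tendstoD) linarith
  then show ?thesis
    using eventually_at_right_less
  proof eventually_elim
    case (elim s)
    have "t * of_int k \<le> s * of_int k"
      using elim(2) assms by (intro mult_right_mono) auto
    then show ?case
      using elim(1) by linarith
  qed
qed

text \<open>Finite support lets one right neighbourhood of \<open>t\<close> serve all components at
  once; off the support both values are 0.\<close>

lemma round_down_mult_eventually_const_at_right: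
  assumes "finite (divisor_supp D)" and "\<And>\<eta>. 0 \<le> D \<eta>"
  shows "\<forall>\<^sub>F s in at_right t. round_down_mult s D = round_down_mult t D"
proof -
  have "\<forall>\<^sub>F s in at_right t. \<forall>\<eta>\<in>divisor_supp D. \<lfloor>s * of_int (D \<eta>)\<rfloor> = \<lfloor>t * of_int (D \<eta>)\<rfloor>"
    using assms by (simp add: eventually_ball_finite_distrib floor_mult_eventually_const_at_right)
  then show ?thesis
  proof eventually_elim
    case (elim s)
    show ?case
    proof
      fix \<eta>
      show "round_down_mult s D \<eta> = round_down_mult t D \<eta>"
        using elim by (cases "D \<eta> = 0") (auto simp: round_down_mult_def divisor_supp_def)
    qed
  qed
qed

text \<open>Contraposed, \<open>ev\<close> says that the complement of \<open>S\<close> is open for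
  the topology of half-open intervals \<open>[t, b)\<close>.\<close>

lemma is_minimum_INF:
  fixes S :: "real set"
  assumes fin: "\<bar>INF t\<in>S. ereal t\<bar> \<noteq> \<infinity>"
    and ev: "\<And>t. \<forall>\<^sub>F s in at_right t. s \<in> S \<longrightarrow> t \<in> S"
  shows "is_minimum S (INF t\<in>S. ereal t)"
proof -
  \<comment> \<open>Finiteness rules out an empty \<open>S\<close>, whose infimum is
    \<open>\<infinity>\<close>, and an \<open>S\<close> unbounded below.\<close>
  obtain c where c: "(INF t\<in>S. ereal t) = ereal c"
    using fin by (cases "INF t\<in>S. ereal t") auto
  have lb: "\<forall>s\<in>S. c \<le> s"
    by (metis INF_lower c ereal_less_eq(3))
  have "c \<in> S"
  proof (rule ccontr)
    assume "c \<notin> S"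
    with ev[of c] obtain b where b: "b > c" "\<And>s. c < s \<Longrightarrow> s < b \<Longrightarrow> s \<notin> S"
      by (auto simp: eventually_at_right_field)
    \<comment> \<open>As \<open>S\<close> misses all of \<open>[c, b)\<close>, \<open>b\<close>
      would be a lower bound exceeding the infimum.\<close>
    have "(INF t\<in>S. ereal t) < ereal b"
      using c b(1) by simp
    then obtain s where "s \<in> S" "s < b"
      by (auto simp: INF_less_iff)
    with lb b(2) \<open>c \<notin> S\<close> show False
      by (metis order_le_less)
  qed
  with c lb show ?thesis
    by (auto simp: is_minimum_def)
qed

text \<open>\<open>Q\<close> abstracts the vanishing condition, so that both thresholds are
  instances; \<open>S\<close> is given by an equation to match their defining equations.\<close>

lemma is_minimum_INF_round_down_mult:
  assumes "finite (divisor_supp D)" and "\<And>\<eta>. 0 \<le> D \<eta>"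
    and S: "S = {t. t \<ge> 0 \<and> Q (round_down_mult t D)}"
    and fin: "\<bar>INF t\<in>S. ereal t\<bar> \<noteq> \<infinity>"
  shows "is_minimum S (INF t\<in>S. ereal t)"
proof (rule is_minimum_INF[OF fin])
  fix t :: real
  show "\<forall>\<^sub>F s in at_right t. s \<in> S \<longrightarrow> t \<in> S"
  proof (cases "0 \<le> t")
    case True
    from round_down_mult_eventually_const_at_right[OF assms(1,2), of t] show ?thesis
      by eventually_elim (use True S in auto)
  next
    case False
    \<comment> \<open>Here \<open>t \<notin> S\<close>, so the implication can hold only because
      nearby \<open>s\<close> are negative and lie outside \<open>S\<close> too.\<close>
    then have "\<forall>\<^sub>F s in at_right t. s < 0"
      by (intro eventually_at_rightI[of t 0]) auto
    then show ?thesis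
      by eventually_elim (use S in auto)
  qed
qed

theorem lemma4p6:
  fixes R :: "'r ring"
    and \<aa> J :: "'r set"
    and xs :: "'r list"
    and Z :: "('z, 's) rspace"
    and \<pi> :: "('z, 's, 'r set, 'r set \<Rightarrow> ('r \<times> 'r) set) mor"
    and D :: "'z \<Rightarrow> int"
    and P :: "('r, 'q) mod_complex"
    and aug :: "'q \<Rightarrow> 'r set"
    and Res :: "('z, 's, ('z set \<times> 's) set) msheaf
                  \<Rightarrow> ('z, 's, ('z set \<times> 's) set, 'v) sheaf_resolution"
  assumes "domain R" and "excellent_ring R" and "contains_rationals R"
    and "has_dualizing_complex R"
    and "ideal \<aa> R" and "\<aa> \<noteq> {\<zero>\<^bsub>R\<^esub>}"
    and "set xs \<subseteq> carrier R" and "J = genideal R (set xs)" and "J \<noteq> {\<zero>\<^bsub>R\<^esub>}"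
    and "\<aa> \<subseteq> radical R J"
    and "log_resolution R \<aa> Z \<pi> D"
    and "projective_resolution R (quotient_module R J) P aug"
    and "\<And>E. is_divisor Z E \<Longrightarrow>
           injective_resolution Z (divisor_sheaf Z E) (Res (divisor_sheaf Z E))"
    and "\<bar>c_Hir R Z \<pi> D J P aug Res\<bar> \<noteq> \<infinity>"
    and "\<bar>c_KH R Z \<pi> D xs Res\<bar> \<noteq> \<infinity>"
  shows "is_minimum (Hir_set R Z \<pi> D J P aug Res) (c_Hir R Z \<pi> D J P aug Res)
       \<and> is_minimum (KH_set R Z \<pi> D xs Res) (c_KH R Z \<pi> D xs Res)"
proof -
  have D: "finite (divisor_supp D)" "\<And>\<eta>. 0 \<le> D \<eta>"
    using \<open>log_resolution R \<aa> Z \<pi> D\<close> by (auto simp: log_resolution_def is_divisor_def)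
  have "is_minimum (Hir_set R Z \<pi> D J P aug Res) (c_Hir R Z \<pi> D J P aug Res)"
    using \<open>\<bar>c_Hir R Z \<pi> D J P aug Res\<bar> \<noteq> \<infinity>\<close> unfolding c_Hir_def
    \<comment> \<open>Unification finds \<open>Q\<close>, since \<open>t\<close> enters the
      condition only through \<open>round_down_mult t D\<close>; the lift \<open>e\<close> of 1 does
      not depend on \<open>t\<close>.\<close>
    by (rule is_minimum_INF_round_down_mult[OF D Hir_set_def])
  moreover have "is_minimum (KH_set R Z \<pi> D xs Res) (c_KH R Z \<pi> D xs Res)"
    using \<open>\<bar>c_KH R Z \<pi> D xs Res\<bar> \<noteq> \<infinity>\<close> unfolding c_KH_def
    by (rule is_minimum_INF_round_down_mult[OF D KH_set_def])
  ultimately show ?thesis ..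
qed

end
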